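(* Let $(\mathcal{X},d)$ be a complete separable metric space and $I=[0,T]\subset\mathbb{R}$. Let $1<p<\infty$, $\frac1p<\alpha<1$, and $(\mu_t)\in W^{\alpha,p}(I;P_p(\mathcal{X}))$. Assume that $(\mu_t)$ has a lift $\pi\in P(C(I;\mathcal{X}))$, i.e. $(e_t)_\#\pi=\mu_t$ for all $t\in I$, whose $W^{\alpha,p}$-energy satisfies $$|\mu|_{W^{\alpha,p}}^p=\int_{C(I;\mathcal{X})}|\gamma|_{W^{\alpha,p}}^p\,d\pi(\gamma).$$ Then $(\mu_t)_{t\in I}$ is compatible in $P_p(\mathcal{X})$.
   Context: $C(I;\mathcal{X})$ is the space of continuous paths with the supremum distance and its Borel $\sigma$-algebra; $P(\mathcal{Y})$ denotes Borel probability measures on $\mathcal{Y}$; $e_t(\gamma)=\gamma_t$. $P_p(\mathcal{X})$ is the set of Borel probability measures with finite $p$-th moment, with the $p$-Wasserstein distance $W_p$. For a metric space $(\mathcal{Y},\rho)$ and a path $X:[0,T]\to\mathcal{Y}$, $|X|_{W^{\alpha,p}}=\big(\iint_{[0,T]^2}\rho(X_s,X_t)^p|t-s|^{-1-\alpha p}\,ds\,dt\big)^{1/p}$, and (for $\alpha>1/p$) $W^{\alpha,p}([0,T];\mathcal{Y})$ is the set of continuous paths $X$ with $|X|_{W^{\alpha,p}}<\infty$. For curves of measures take $(\mathcal{Y},\rho)=(P_p(\mathcal{X}),W_p)$. Compatibility: a collection $\mathcal{M}\subset P_p(\mathcal{X})$ is compatible if for every finite subcollection of $\mathcal{M}$ there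 exists a multi-coupling (a probability measure on the corresponding finite product of copies of $\mathcal{X}$ having the given measures as one-dimensional marginals) such that all of its two-dimensional marginals are optimal couplings for the cost $d(x,y)^p$. *)

theory Defs
  imports "HOL-Probability.Probability"
begin

definition finite_moment_measures :: "real \<Rightarrow> ('a::polish_space) measure set" where
  "finite_moment_measures p = {\<mu>. prob_space \<mu> \<and> sets \<mu> = sets borel \<and>
     (\<exists>x\<^sub>0. (\<integral>\<^sup>+x. ennreal (dist x\<^sub>0 x powr p) \<partial>\<mu>) < \<infinity>)}"

definition couplings :: "('a::polish_space) measure \<Rightarrow> 'a measure \<Rightarrow> ('a \<times> 'a) measure set" where
  "couplings \<mu> \<nu> = {\<kappa>. prob_space \<kappa> \<and> sets \<kappa> = sets (borel \<Otimes>\<^sub>M borel) \<and>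
     distr \<kappa> borel fst = \<mu> \<and> distr \<kappa> borel snd = \<nu>}"

definition transport_cost :: "real \<Rightarrow> ('a::polish_space \<times> 'a) measure \<Rightarrow> ennreal" where
  "transport_cost p \<kappa> = (\<integral>\<^sup>+(x, y). ennreal (dist x y powr p) \<partial>\<kappa>)"

definition optimal_couplings ::
  "real \<Rightarrow> ('a::polish_space) measure \<Rightarrow> 'a measure \<Rightarrow> ('a \<times> 'a) measure set" where
  "optimal_couplings p \<mu> \<nu> =
     {\<kappa> \<in> couplings \<mu> \<nu>. \<forall>\<kappa>' \<in> couplings \<mu> \<nu>. transport_cost p \<kappa> \<le> transport_cost p \<kappa>'}"

text \<open>On measures with finite \<open>p\<close>-th moment the infimum is finite, so that \<open>enn2real\<close> is harmless.\<close>

definition wasserstein :: "real \<Rightarrow> ('a::polish_space) measure \<Rightarrow> 'a measure \<Rightarrow> real" where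
  "wasserstein p \<mu> \<nu> = enn2real (INF \<kappa>\<in>couplings \<mu> \<nu>. transport_cost p \<kappa>) powr (1 / p)"

definition ennreal_powr :: "ennreal \<Rightarrow> real \<Rightarrow> ennreal" where
  \<comment> \<open>used for positive exponents only\<close>
  "ennreal_powr x r = (if x = \<infinity> then \<infinity> else ennreal (enn2real x powr r))"

text \<open>
  A path on \<open>[0, T]\<close> in a metric space with distance \<open>\<rho>\<close> is a function on the reals of which only the
  values on \<open>[0, T]\<close> matter. The seminorm takes the value \<open>\<infinity>\<close> when the double integral diverges.
  On the diagonal \<open>s = t\<close> the integrand is \<open>0\<close>, as \<open>0 powr r = 0\<close>.
\<close>

definition sobolev_seminorm ::
  "('b \<Rightarrow> 'b \<Rightarrow> real) \<Rightarrow> real \<Rightarrow> real \<Rightarrow> real \<Rightarrow> (real \<Rightarrow> 'b) \<Rightarrow> ennreal" where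
  "sobolev_seminorm \<rho> T \<alpha> p X = ennreal_powr
     (\<integral>\<^sup>+(s, t)\<in>{0..T} \<times> {0..T}. ennreal (\<rho> (X s) (X t) powr p * \<bar>t - s\<bar> powr (- 1 - \<alpha> * p))
        \<partial>(lborel \<Otimes>\<^sub>M lborel)) (1 / p)"

definition continuous_path :: "'b set \<Rightarrow> ('b \<Rightarrow> 'b \<Rightarrow> real) \<Rightarrow> real \<Rightarrow> (real \<Rightarrow> 'b) \<Rightarrow> bool" where
  "continuous_path Y \<rho> T X \<longleftrightarrow> X ` {0..T} \<subseteq> Y \<and>
     (\<forall>t\<in>{0..T}. \<forall>\<epsilon>>0. \<exists>\<delta>>0. \<forall>s\<in>{0..T}. \<bar>s - t\<bar> < \<delta> \<longrightarrow> \<rho> (X s) (X t) < \<epsilon>)"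

definition sobolev_paths ::
  "'b set \<Rightarrow> ('b \<Rightarrow> 'b \<Rightarrow> real) \<Rightarrow> real \<Rightarrow> real \<Rightarrow> real \<Rightarrow> (real \<Rightarrow> 'b) set" where
  "sobolev_paths Y \<rho> T \<alpha> p = {X. continuous_path Y \<rho> T X \<and> sobolev_seminorm \<rho> T \<alpha> p X < \<infinity>}"

text \<open>
  \<open>C([0, T]; X)\<close> with the supremum distance. The library's \<open>cfunspace\<close> consists of the bounded
  continuous functions (boundedness is automatic here), extended by \<open>undefined\<close> outside \<open>[0, T]\<close>.
\<close>

definition path_space :: "real \<Rightarrow> (real \<Rightarrow> 'a::polish_space) metric" where
  "path_space T = cfunspace (top_of_set {0..T}) euclidean_metric"

definition metric_borel :: "'b metric \<Rightarrow> 'b measure" where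
  "metric_borel m = sigma (mspace m) {U. openin (mtopology_of m) U}"

definition is_lift :: "real \<Rightarrow> (real \<Rightarrow> ('a::polish_space) measure) \<Rightarrow> (real \<Rightarrow> 'a) measure \<Rightarrow> bool" where
  "is_lift T \<mu> \<pi> \<longleftrightarrow> prob_space \<pi> \<and> sets \<pi> = sets (metric_borel (path_space T)) \<and>
     (\<forall>t\<in>{0..T}. distr \<pi> borel (\<lambda>\<gamma>. \<gamma> t) = \<mu> t)"

text \<open>The finite product attached to a finite subcollection \<open>F\<close> is indexed by \<open>F\<close> itself.\<close>

definition multi_couplings :: "('a::polish_space) measure set \<Rightarrow> ('a measure \<Rightarrow> 'a) measure set" where
  "multi_couplings F = {\<kappa>. prob_space \<kappa> \<and> sets \<kappa> = sets (\<Pi>\<^sub>M \<mu>\<in>F. borel) \<and>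
     (\<forall>\<mu>\<in>F. distr \<kappa> borel (\<lambda>x. x \<mu>) = \<mu>)}"

definition compatible :: "real \<Rightarrow> ('a::polish_space) measure set \<Rightarrow> bool" where
  "compatible p \<M> \<longleftrightarrow> \<M> \<subseteq> finite_moment_measures p \<and>
     (\<forall>F. finite F \<and> F \<subseteq> \<M> \<longrightarrow>
        (\<exists>\<kappa>\<in>multi_couplings F. \<forall>\<mu>\<in>F. \<forall>\<nu>\<in>F. \<mu> \<noteq> \<nu> \<longrightarrow>
           distr \<kappa> (borel \<Otimes>\<^sub>M borel) (\<lambda>x. (x \<mu>, x \<nu>)) \<in> optimal_couplings p \<mu> \<nu>))"

end

theory Submission
  imports Defs
begin

text \<open>
  Let \<open>g s t\<close> be the \<open>\<pi>\<close>-mean of \<open>dist (\<gamma> s) (\<gamma> t) powr p\<close>. The law of \<open>(\<gamma> s, \<gamma> t)\<close> couples \<open>\<mu> s\<close> and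
  \<open>\<mu> t\<close>, so \<open>W s t powr p \<le> g s t\<close>; by Fubini the two energies are the integrals of these
  functions against the same positive weight, and as they agree and are finite, \<open>W s t powr p = g s t\<close>
  for almost every \<open>(s, t)\<close>. By Fatou \<open>g\<close> is lower semicontinuous, and \<open>W\<close> is continuous, so the
  equality holds everywhere: all two-dimensional marginals of \<open>\<pi>\<close> are optimal. Restricting \<open>\<pi>\<close> to
  finitely many times gives the required multi-coupling.

  For the continuity of \<open>W\<close>, disintegration is avoided: two couplings are glued only approximately, by
  matching the cell of a countable partition into small sets in which their common marginals lie. This
  yields a triangle inequality for the transport cost with constants, one of them arbitrarily close
  to 1, which is enough.
\<close>

section \<open>Lower integrals of arbitrary functions\<close>

text \<open>The integral is a supremum over simple functions below \<open>f\<close>. A sequence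
  \<open>S\<close> of their integrals already reaches this supremum, and the pointwise supremum
  \<open>h\<close> of the corresponding simple functions is measurable and still below
  \<open>f\<close>.\<close>

lemma nn_integral_attained_by_measurable:
  "\<exists>h\<in>borel_measurable M. h \<le> f \<and> integral\<^sup>N M h = integral\<^sup>N M f"
proof -
  obtain S :: "nat \<Rightarrow> ennreal" where S: "range S \<subseteq> integral\<^sup>S M ` {g. simple_function M g \<and> g \<le> f}"
    and S_Sup: "(SUP n. S n) = integral\<^sup>N M f"
  proof -
    have "(\<lambda>_. 0) \<in> {g. simple_function M g \<and> g \<le> f}"
      by (auto simp: le_fun_def)
    then have "integral\<^sup>S M ` {g. simple_function M g \<and> g \<le> f} \<noteq> {}"
      by blast
    from ennreal_Sup_countable_SUP[OF this] obtain S :: "nat \<Rightarrow> ennreal" where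
      "incseq S" "range S \<subseteq> integral\<^sup>S M ` {g. simple_function M g \<and> g \<le> f}"
      "Sup (integral\<^sup>S M ` {g. simple_function M g \<and> g \<le> f}) = (SUP n. S n)"
      by metis
    then show thesis
      by (intro that[of S]) (simp_all only: nn_integral_def)
  qed
  have "\<exists>g. simple_function M g \<and> g \<le> f \<and> integral\<^sup>S M g = S n" for n
    using subsetD[OF S rangeI[of S n]] by (auto simp: image_iff)
  then obtain g where g: "\<And>n. simple_function M (g n)" "\<And>n. g n \<le> f" "\<And>n. integral\<^sup>S M (g n) = S n"
    by metis
  define h where "h x = (SUP n. g n x)" for x
  show ?thesis
  proof (intro bexI[of _ h] conjI)
    show "h \<in> borel_measurable M"
      unfolding h_def
      by (intro borel_measurable_SUP borel_measurable_simple_function g(1) countableI_type)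
    show h_le: "h \<le> f"
      unfolding h_def by (intro le_funI SUP_least) (rule le_funD[OF g(2)])
    have "S n \<le> integral\<^sup>N M h" for n
    proof -
      have "S n = integral\<^sup>N M (g n)"
        using g(1,3)[of n] nn_integral_eq_simple_integral[of M "g n"] by simp
      also have "\<dots> \<le> integral\<^sup>N M h"
        unfolding h_def by (intro nn_integral_mono SUP_upper) simp
      finally show ?thesis .
    qed
    then have "integral\<^sup>N M f \<le> integral\<^sup>N M h"
      unfolding S_Sup[symmetric] by (rule SUP_least)
    moreover have "integral\<^sup>N M h \<le> integral\<^sup>N M f"
      by (intro nn_integral_mono le_funD[OF h_le])
    ultimately show "integral\<^sup>N M h = integral\<^sup>N M f"
      by (rule antisym[rotated])
  qed
qed

text \<open>
  No measurability of \<open>f\<close> is required: \<open>nn_integral\<close> is a lower integral. So measurability of \<open>W\<close> in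
  \<open>(s, t)\<close> never has to be established.
\<close>

lemma AE_eq_of_nn_integral_eq:
  assumes [measurable]: "g \<in> borel_measurable M"
    and le: "\<And>x. f x \<le> g x"
    and eq: "integral\<^sup>N M f = integral\<^sup>N M g" and fin: "integral\<^sup>N M g < \<infinity>"
  shows "AE x in M. f x = g x"
proof -
  obtain h where h[measurable]: "h \<in> borel_measurable M" and h_le: "h \<le> f"
    and int_h: "integral\<^sup>N M h = integral\<^sup>N M f"
    using nn_integral_attained_by_measurable[of M f] by metis
  from le_funD[OF h_le] have hf: "\<And>x. h x \<le> f x" .
  from int_h eq fin have "\<not> integral\<^sup>N M h < integral\<^sup>N M g" "integral\<^sup>N M h \<noteq> \<infinity>"
    by auto
  \<comment> \<open>Since \<open>h\<close> \<le> \<open>f\<close> \<le> \<open>g\<close>, a failure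
    of \<open>g\<close> \<le> \<open>h\<close> on a non-null set would, by
    \<open>nn_integral_less\<close>, put the finite integral of \<open>h\<close> strictly below that
    of \<open>g\<close>.\<close>
  then have "AE x in M. g x \<le> h x"
    using nn_integral_less[OF h assms(1)] order_trans[OF hf le] by (meson AE_I2)
  then show ?thesis
    by eventually_elim (rule antisym[OF le order_trans[OF _ hf]])
qed

subsection \<open>Evaluation of paths\<close>

text \<open>Evaluation is 1-Lipschitz for the supremum distance, so preimages of open sets are
  open.\<close>

lemma measurable_evaluation:
  assumes t: "t \<in> {0..T}"
  shows "(\<lambda>\<gamma>. \<gamma> t) \<in> borel_measurable (metric_borel (path_space T :: (real \<Rightarrow> 'a::polish_space) metric))"
proof (rule borel_measurableI)
  fix U :: "'a set" assume U: "open U"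
  let ?m = "path_space T :: (real \<Rightarrow> 'a) metric"
  have mspace: "space (metric_borel ?m) = mspace ?m"
    by (simp add: metric_borel_def space_measure_of_conv)
  have "openin (mtopology_of ?m) {\<gamma> \<in> mspace ?m. \<gamma> t \<in> U}"
    unfolding mtopology_of_def Metric_space.openin_mtopology[OF Metric_space_mspace_mdist]
  proof safe
    fix \<gamma> assume \<gamma>: "\<gamma> \<in> mspace ?m" "\<gamma> t \<in> U"
    obtain e where e: "e > 0" "\<And>y. dist (\<gamma> t) y < e \<Longrightarrow> y \<in> U"
      using U \<gamma>(2) by (metis dist_commute open_dist)
    have "Metric_space.mball (mspace ?m) (mdist ?m) \<gamma> e \<subseteq> {\<gamma> \<in> mspace ?m. \<gamma> t \<in> U}"
    proof
      fix \<eta> assume "\<eta> \<in> Metric_space.mball (mspace ?m) (mdist ?m) \<gamma> e"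
      then have \<eta>: "\<eta> \<in> mspace ?m" "mdist ?m \<gamma> \<eta> < e"
        by (auto simp: Metric_space.in_mball[OF Metric_space_mspace_mdist])
      have fs: "\<gamma> \<in> mspace (funspace {0..T} euclidean_metric)" "\<eta> \<in> mspace (funspace {0..T} euclidean_metric)"
        using \<gamma>(1) \<eta>(1) by (auto simp: path_space_def cfunspace_def)
      have "dist (\<gamma> t) (\<eta> t) \<le> mdist ?m \<gamma> \<eta>"
        using funspace_mdist_le[OF fs, of "mdist ?m \<gamma> \<eta>"] t
        by (auto simp: path_space_def cfunspace_def)
      with e(2) \<eta> show "\<eta> \<in> {\<gamma> \<in> mspace ?m. \<gamma> t \<in> U}"
        by auto
    qed
    with e(1) show "\<exists>r>0. Metric_space.mball (mspace ?m) (mdist ?m) \<gamma> r \<subseteq> {\<gamma> \<in> mspace ?m. \<gamma> t \<in> U}"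
      by blast
  qed
  moreover have "sets (metric_borel ?m) = sigma_sets (mspace ?m) {U. openin (mtopology_of ?m) U}"
    unfolding metric_borel_def using openin_subset[of "mtopology_of ?m"]
    by (intro sets_measure_of) (simp add: subset_iff)
  moreover have "(\<lambda>\<gamma>. \<gamma> t) -` U \<inter> mspace ?m = {\<gamma> \<in> mspace ?m. \<gamma> t \<in> U}"
    by blast
  ultimately show "(\<lambda>\<gamma>. \<gamma> t) -` U \<inter> space (metric_borel ?m) \<in> sets (metric_borel ?m)"
    unfolding mspace by (simp add: sigma_sets.Basic)
qed

lemma path_continuous_on:
  assumes "\<gamma> \<in> mspace (path_space T :: (real \<Rightarrow> 'a::polish_space) metric)"
  shows "continuous_on {0..T} \<gamma>"
proof -
  have "continuous_map (top_of_set {0..T}) euclidean \<gamma>"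
    using assms unfolding path_space_def mspace_cfunspace mtopology_of_euclidean by blast
  then show ?thesis
    by (rule continuous_map_iff_continuous[THEN iffD1])
qed

text \<open>A Caratheodory argument: evaluation is measurable in the path and continuous in time,
  hence a limit of evaluations at times rounded to a grid. Clipping to \<open>[0, T]\<close> makes
  the map total on the reals.\<close>

lemma measurable_path_evaluation:
  fixes \<pi> :: "(real \<Rightarrow> 'a::polish_space) measure"
  assumes "0 \<le> T"
    and ev: "\<And>t. t \<in> {0..T} \<Longrightarrow> (\<lambda>\<gamma>. \<gamma> t) \<in> borel_measurable \<pi>"
    and cont: "\<And>\<gamma>. \<gamma> \<in> space \<pi> \<Longrightarrow> continuous_on {0..T} \<gamma>"
  shows "(\<lambda>(\<gamma>, t). \<gamma> (max 0 (min T t))) \<in> borel_measurable (\<pi> \<Otimes>\<^sub>M borel)"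
proof (rule borel_measurable_LIMSEQ_metric)
  define r :: "nat \<Rightarrow> real \<Rightarrow> int" where "r n t = \<lfloor>real (Suc n) * t\<rfloor>" for n t
  define f where "f n x = fst x (max 0 (min T (r n (snd x) / real (Suc n))))"
    for n and x :: "(real \<Rightarrow> 'a) \<times> real"
  have clip: "max 0 (min T t) \<in> {0..T}" for t
    using \<open>0 \<le> T\<close> by auto
  \<comment> \<open>The rounded time takes countably many values, and for each of them the
    evaluation time is fixed. Clipping after rounding keeps that time in \<open>{0..T}\<close>,
    where \<open>ev\<close> and \<open>cont\<close> apply.\<close>
  show "f n \<in> borel_measurable (\<pi> \<Otimes>\<^sub>M borel)" for n
    unfolding f_def
  proof (rule measurable_compose_countable[where g="\<lambda>x. r n (snd x)"
        and f="\<lambda>i x. fst x (max 0 (min T (real_of_int i / real (Suc n))))"])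
    show "(\<lambda>x. fst x (max 0 (min T (real_of_int i / real (Suc n))))) \<in> borel_measurable (\<pi> \<Otimes>\<^sub>M borel)" for i
      using measurable_comp[OF measurable_fst ev[OF clip]] by (simp add: o_def)
    show "(\<lambda>x. r n (snd x)) \<in> (\<pi> \<Otimes>\<^sub>M borel) \<rightarrow>\<^sub>M count_space UNIV"
      unfolding r_def by measurable
  qed
  have r_lim: "(\<lambda>n. r n t / real (Suc n)) \<longlonglongrightarrow> t" for t
  proof (rule tendsto_sandwich)
    show "(\<lambda>n. t - 1 / real (Suc n)) \<longlonglongrightarrow> t"
      using tendsto_diff[OF tendsto_const lim_inverse_n'[THEN LIMSEQ_Suc], of t] by simp
    show "\<forall>\<^sub>F n in sequentially. t - 1 / real (Suc n) \<le> r n t / real (Suc n)"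
    proof (rule always_eventually, rule allI)
      fix n
      have "real (Suc n) * t - 1 \<le> r n t"
        unfolding r_def by linarith
      then have "(real (Suc n) * t - 1) / real (Suc n) \<le> r n t / real (Suc n)"
        by (rule divide_right_mono) simp
      then show "t - 1 / real (Suc n) \<le> r n t / real (Suc n)"
        by (simp add: diff_divide_distrib)
    qed
    show "\<forall>\<^sub>F n in sequentially. r n t / real (Suc n) \<le> t"
    proof (rule always_eventually, rule allI)
      fix n
      have "r n t \<le> t * real (Suc n)"
        unfolding r_def by (metis mult.commute of_int_floor_le)
      then show "r n t / real (Suc n) \<le> t"
        by (simp add: divide_le_eq)
    qed
  qed simp
  fix x assume "x \<in> space (\<pi> \<Otimes>\<^sub>M (borel :: real measure))"
  then have c: "continuous_on {0..T} (fst x)"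
    by (auto simp: space_pair_measure intro: cont)
  have "(\<lambda>n. max 0 (min T (r n (snd x) / real (Suc n)))) \<longlonglongrightarrow> max 0 (min T (snd x))"
    by (intro tendsto_intros r_lim)
  then have "(\<lambda>n. fst x (max 0 (min T (r n (snd x) / real (Suc n))))) \<longlonglongrightarrow> fst x (max 0 (min T (snd x)))"
    by (rule continuous_on_tendsto_compose[OF c]) (intro always_eventually allI clip)+
  then show "(\<lambda>n. f n x) \<longlonglongrightarrow> (case x of (\<gamma>, t) \<Rightarrow> \<gamma> (max 0 (min T t)))"
    by (simp add: f_def case_prod_unfold)
qed

subsection \<open>Approximate gluing of couplings\<close>

text \<open>There are only countably many labels, so the null fibers together form a null set. This
  permits dividing by the mass of the fiber below.\<close>

lemma emeasure_label_fiber_AE: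
  assumes [measurable]: "f \<in> k \<rightarrow>\<^sub>M count_space (UNIV :: nat set)"
  shows "AE x in k. emeasure k {x' \<in> space k. f x' = f x} \<noteq> 0"
proof -
  have "AE x in k. \<forall>n. emeasure k {x' \<in> space k. f x' = n} = 0 \<longrightarrow> f x \<noteq> n"
    unfolding AE_all_countable
  proof
    fix n
    have [measurable]: "{x' \<in> space k. f x' = n} \<in> sets k"
      by measurable
    show "AE x in k. emeasure k {x' \<in> space k. f x' = n} = 0 \<longrightarrow> f x \<noteq> n"
      by (cases "emeasure k {x' \<in> space k. f x' = n} = 0")
        (auto intro!: AE_I[where N="{x' \<in> space k. f x' = n}"])
  qed
  then show ?thesis
    by eventually_elim blast
qed

text \<open>A discrete form of gluing: conditioning on a label with countably many values needs only
  elementary conditional probabilities, so the coupling has an explicit density \<open>w\<close>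
  with respect to the product measure.\<close>

lemma coupling_with_equal_labels:
  fixes f :: "'a \<Rightarrow> nat" and g :: "'b \<Rightarrow> nat"
  assumes "prob_space k" "prob_space l"
    and f[measurable]: "f \<in> k \<rightarrow>\<^sub>M count_space UNIV" and g[measurable]: "g \<in> l \<rightarrow>\<^sub>M count_space UNIV"
    and same: "\<And>n. emeasure k {x \<in> space k. f x = n} = emeasure l {y \<in> space l. g y = n}"
  obtains K where "sets K = sets (k \<Otimes>\<^sub>M l)" "distr K k fst = k" "distr K l snd = l"
    "AE z in K. f (fst z) = g (snd z)"
proof
  interpret k: prob_space k by fact
  interpret l: prob_space l by fact
  interpret pair_sigma_finite k l ..
  define m where "m n = emeasure k {x \<in> space k. f x = n}" for n
  have m_l: "m n = emeasure l {y \<in> space l. g y = n}" for n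
    by (simp add: m_def same)
  \<comment> \<open>conditionally on the common label, the two coordinates are independent\<close>
  define w :: "'a \<times> 'b \<Rightarrow> ennreal" where
    "w z = (if f (fst z) = g (snd z) then inverse (m (f (fst z))) else 0)" for z
  \<comment> \<open>Equality of labels is a countable union over the common value.\<close>
  have eq_labels: "{z \<in> space (k \<Otimes>\<^sub>M l). f (fst z) = g (snd z)} \<in> sets (k \<Otimes>\<^sub>M l)"
  proof -
    have "{z \<in> space (k \<Otimes>\<^sub>M l). \<exists>n. g (snd z) = n \<and> f (fst z) = n} \<in> sets (k \<Otimes>\<^sub>M l)"
      by measurable
    then show ?thesis
      by simp
  qed
  have inv_meas: "(\<lambda>z. inverse (m (f (fst z)))) \<in> borel_measurable (k \<Otimes>\<^sub>M l)"
    by (rule measurable_compose[OF measurable_compose[OF measurable_fst f]]) simp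
  have [measurable]: "w \<in> borel_measurable (k \<Otimes>\<^sub>M l)"
    unfolding w_def by (rule measurable_If[OF inv_meas measurable_const eq_labels]) simp
  define K where "K = density (k \<Otimes>\<^sub>M l) w"
  \<comment> \<open>In \<open>ennreal\<close> the inverse of \<open>0\<close> is infinite, so null
    fibers must be excluded here; they are discarded almost everywhere later.\<close>
  have inv: "inverse (m n) * m n = 1" if "m n \<noteq> 0" for n
  proof -
    have "m n < top"
      using k.emeasure_finite by (auto simp: m_def less_top[symmetric])
    with that have "m n / m n = 1"
      by (rule ennreal_divide_self)
    then show ?thesis
      by (simp add: divide_ennreal_def mult.commute)
  qed
  \<comment> \<open>Integrating the density over one coordinate gives \<open>1\<close>; with
    \<open>int_k\<close>, this is what makes both marginals correct.\<close>
  have int_l: "(\<integral>\<^sup>+y. w (x, y) \<partial>l) = 1" if "m (f x) \<noteq> 0" for x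
  proof -
    have "(\<integral>\<^sup>+y. w (x, y) \<partial>l) = (\<integral>\<^sup>+y. inverse (m (f x)) * indicator {y \<in> space l. g y = f x} y \<partial>l)"
      by (intro nn_integral_cong) (auto simp: w_def)
    also have "\<dots> = inverse (m (f x)) * m (f x)"
      by (subst nn_integral_cmult_indicator) (auto simp: m_l)
    finally show ?thesis using inv[OF that] by simp
  qed
  have int_k: "(\<integral>\<^sup>+x. w (x, y) \<partial>k) = 1" if "m (g y) \<noteq> 0" for y
  proof -
    have "(\<integral>\<^sup>+x. w (x, y) \<partial>k) = (\<integral>\<^sup>+x. inverse (m (g y)) * indicator {x \<in> space k. f x = g y} x \<partial>k)"
      by (intro nn_integral_cong) (auto simp: w_def)
    also have "\<dots> = inverse (m (g y)) * m (g y)"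
      by (subst nn_integral_cmult_indicator) (auto simp: m_def)
    finally show ?thesis using inv[OF that] by simp
  qed
  show sets_K: "sets K = sets (k \<Otimes>\<^sub>M l)"
    by (simp add: K_def)
  note [measurable_cong] = sets_K
  have space_K: "space K = space k \<times> space l"
    by (simp add: K_def space_pair_measure)
  show "distr K k fst = k"
  proof (rule measure_eqI)
    fix A assume "A \<in> sets (distr K k fst)"
    then have A[measurable]: "A \<in> sets k" by simp
    have "emeasure (distr K k fst) A = emeasure K (fst -` A \<inter> space K)"
      by (rule emeasure_distr) auto
    also have "\<dots> = (\<integral>\<^sup>+z. w z * indicator (fst -` A \<inter> space K) z \<partial>(k \<Otimes>\<^sub>M l))"
      unfolding K_def by (rule emeasure_density) auto
    also have "\<dots> = (\<integral>\<^sup>+z. w z * indicator A (fst z) \<partial>(k \<Otimes>\<^sub>M l))"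
      by (intro nn_integral_cong) (auto simp: space_K space_pair_measure split: split_indicator)
    also have "\<dots> = (\<integral>\<^sup>+x. \<integral>\<^sup>+y. w (x, y) * indicator A x \<partial>l \<partial>k)"
      by (subst l.nn_integral_fst[symmetric]) auto
    also have "\<dots> = (\<integral>\<^sup>+x. (\<integral>\<^sup>+y. w (x, y) \<partial>l) * indicator A x \<partial>k)"
      by (intro nn_integral_cong nn_integral_multc) measurable
    also have "\<dots> = (\<integral>\<^sup>+x. indicator A x \<partial>k)"
      using emeasure_label_fiber_AE[OF f]
      by (intro nn_integral_cong_AE) (auto simp: int_l m_def)
    finally show "emeasure (distr K k fst) A = emeasure k A"
      by simp
  qed simp
  show "distr K l snd = l"
  proof (rule measure_eqI)
    fix A assume "A \<in> sets (distr K l snd)"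
    then have A[measurable]: "A \<in> sets l" by simp
    have "emeasure (distr K l snd) A = emeasure K (snd -` A \<inter> space K)"
      by (rule emeasure_distr) auto
    also have "\<dots> = (\<integral>\<^sup>+z. w z * indicator (snd -` A \<inter> space K) z \<partial>(k \<Otimes>\<^sub>M l))"
      unfolding K_def by (rule emeasure_density) auto
    also have "\<dots> = (\<integral>\<^sup>+z. w z * indicator A (snd z) \<partial>(k \<Otimes>\<^sub>M l))"
      by (intro nn_integral_cong) (auto simp: space_K space_pair_measure split: split_indicator)
    also have "\<dots> = (\<integral>\<^sup>+y. \<integral>\<^sup>+x. w (x, y) * indicator A y \<partial>k \<partial>l)"
      by (subst nn_integral_snd[symmetric]) auto
    also have "\<dots> = (\<integral>\<^sup>+y. (\<integral>\<^sup>+x. w (x, y) \<partial>k) * indicator A y \<partial>l)"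
      by (intro nn_integral_cong nn_integral_multc) measurable
    also have "\<dots> = (\<integral>\<^sup>+y. indicator A y \<partial>l)"
      using emeasure_label_fiber_AE[OF g]
      by (intro nn_integral_cong_AE) (auto simp: int_k m_l)
    finally show "emeasure (distr K l snd) A = emeasure l A"
      by simp
  qed simp
  show "AE z in K. f (fst z) = g (snd z)"
    unfolding K_def by (subst AE_density) (auto simp: w_def)
qed

text \<open>The label of a point is the index of the first member of a dense sequence within
  \<open>e / 2\<close> of it. Equal labels thus mean a common nearby point.\<close>

lemma countable_label_of_small_cells:
  fixes e :: real
  assumes "e > 0"
  shows "\<exists>idx \<in> borel \<rightarrow>\<^sub>M count_space (UNIV :: nat set).
    \<forall>x y :: 'a::{metric_space, second_countable_topology}. idx x = idx y \<longrightarrow> dist x y < e"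
proof -
  obtain D :: "'a set" where D: "countable D" "\<And>X. open X \<Longrightarrow> X \<noteq> {} \<Longrightarrow> \<exists>d\<in>D. d \<in> X"
    using countable_dense_setE by blast
  have "D \<noteq> {}"
    using D(2)[of UNIV] by auto
  define q where "q = from_nat_into D"
  define idx where "idx x = (LEAST n. dist x (q n) < e / 2)" for x :: 'a
  have near: "dist x (q (idx x)) < e / 2" for x
  proof -
    obtain d where "d \<in> D" "dist x d < e / 2"
      using D(2)[of "ball x (e / 2)"] assms by auto
    moreover obtain n where "q n = d"
      using \<open>d \<in> D\<close> from_nat_into_surj[OF D(1)] unfolding q_def by blast
    ultimately have "dist x (q n) < e / 2" by simp
    then show ?thesis
      unfolding idx_def by (rule LeastI)
  qed
  show ?thesis
  proof (intro bexI[of _ idx] allI impI)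
    show "idx \<in> borel \<rightarrow>\<^sub>M count_space UNIV"
      unfolding idx_def by measurable
    show "dist x y < e" if "idx x = idx y" for x y
      using near[of x] near[of y] that dist_triangle2[of x y "q (idx x)"] by (simp add: dist_commute)
  qed
qed

subsection \<open>The optimal transport cost\<close>

text \<open>A linear substitute for Minkowski's inequality, used with \<open>d\<close> small.\<close>

lemma powr_add_le_weighted:
  fixes a b d p :: real
  assumes "a \<ge> 0" "b \<ge> 0" "d > 0" "p \<ge> 0"
  shows "(a + b) powr p \<le> (1 + d) powr p * a powr p + (1 + 1 / d) powr p * b powr p"
\<comment> \<open>In either case the dominant summand absorbs the other: \<open>a + b\<close> is at
  most \<open>(1 + d) * a\<close> or at most \<open>(1 + 1 / d) * b\<close>.\<close>
proof (cases "b \<le> d * a")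
  case True
  then have "(a + b) powr p \<le> ((1 + d) * a) powr p"
    using assms by (intro powr_mono2) (auto simp: algebra_simps)
  also have "\<dots> = (1 + d) powr p * a powr p"
    using assms by (simp add: powr_mult)
  finally show ?thesis
    by (smt (verit) powr_ge_zero mult_nonneg_nonneg)
next
  case False
  then have "a \<le> b / d"
    using assms by (simp add: pos_le_divide_eq mult.commute)
  then have "(a + b) powr p \<le> ((1 + 1 / d) * b) powr p"
    using assms by (intro powr_mono2) (auto simp: algebra_simps)
  also have "\<dots> = (1 + 1 / d) powr p * b powr p"
    using assms by (simp add: powr_mult)
  finally show ?thesis
    by (smt (verit) powr_ge_zero mult_nonneg_nonneg)
qed

lemma measurable_dist_powr [measurable]:
  assumes [measurable]: "f \<in> borel_measurable M" "g \<in> borel_measurable M"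
  shows "(\<lambda>x. ennreal (dist (f x) (g x :: 'a::polish_space) powr p)) \<in> borel_measurable M"
  by measurable

lemma couplingsD:
  assumes "\<kappa> \<in> couplings \<mu> \<nu>"
  shows "prob_space \<kappa>" "sets \<kappa> = sets (borel \<Otimes>\<^sub>M borel)"
    "distr \<kappa> borel fst = \<mu>" "distr \<kappa> borel snd = \<nu>"
  using assms by (auto simp: couplings_def)

lemma coupling_distrI:
  assumes "prob_space M" and [measurable]: "f \<in> borel_measurable M" "g \<in> borel_measurable M"
    and "distr M borel f = \<mu>" "distr M borel g = \<nu>"
  shows "distr M (borel \<Otimes>\<^sub>M borel) (\<lambda>x. (f x, g x)) \<in> couplings \<mu> \<nu>"
  using assms by (auto simp: couplings_def distr_distr o_def intro: prob_space.prob_space_distr)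

lemma transport_cost_distr:
  assumes [measurable]: "f \<in> borel_measurable M" "g \<in> borel_measurable M"
  shows "transport_cost p (distr M (borel \<Otimes>\<^sub>M borel) (\<lambda>x. (f x, g x))) =
    (\<integral>\<^sup>+x. ennreal (dist (f x) (g x) powr p) \<partial>M)"
  unfolding transport_cost_def by (subst nn_integral_distr) (auto simp: case_prod_unfold)

lemma transport_cost_eq:
  "transport_cost p \<kappa> = (\<integral>\<^sup>+z. ennreal (dist (fst z) (snd z) powr p) \<partial>\<kappa>)"
  by (simp add: transport_cost_def case_prod_unfold)

text \<open>This is the \<open>p\<close>-th power of the Wasserstein distance, kept in
  \<open>ennreal\<close> so that it can be compared with integrals directly.\<close>

definition ot_cost :: "real \<Rightarrow> ('a::polish_space) measure \<Rightarrow> 'a measure \<Rightarrow> ennreal" where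
  "ot_cost p \<mu> \<nu> = (INF \<kappa>\<in>couplings \<mu> \<nu>. transport_cost p \<kappa>)"

lemma ot_cost_le: "\<kappa> \<in> couplings \<mu> \<nu> \<Longrightarrow> ot_cost p \<mu> \<nu> \<le> transport_cost p \<kappa>"
  unfolding ot_cost_def by (rule INF_lower)

lemma ot_cost_commute_le: "ot_cost p \<nu> \<mu> \<le> ot_cost p \<mu> (\<nu> :: 'a::polish_space measure)"
  unfolding ot_cost_def[of p \<mu>]
proof (rule INF_greatest)
  fix \<kappa> assume "\<kappa> \<in> couplings \<mu> \<nu>"
  note \<kappa> = couplingsD[OF this]
  note [measurable_cong] = \<kappa>(2)
  have "distr \<kappa> (borel \<Otimes>\<^sub>M borel) (\<lambda>z. (snd z, fst z)) \<in> couplings \<nu> \<mu>"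
    by (rule coupling_distrI[OF \<kappa>(1) _ _ \<kappa>(4,3)]) measurable
  from ot_cost_le[OF this, of p] show "ot_cost p \<nu> \<mu> \<le> transport_cost p \<kappa>"
    by (subst (asm) transport_cost_distr) (measurable, simp add: transport_cost_eq dist_commute)
qed

lemma ot_cost_commute: "ot_cost p \<mu> \<nu> = ot_cost p \<nu> \<mu>"
  by (intro antisym ot_cost_commute_le)

text \<open>Couple \<open>k\<close> and \<open>l\<close> so that their \<open>b\<close>-coordinates
  always lie in a common cell of diameter at most \<open>e\<close>. The outer coordinates then form
  a coupling of \<open>a\<close> and \<open>c\<close>, whose cost is bounded along the chain of four
  points. The weight on \<open>l\<close> is close to 1 for small \<open>d\<close>.\<close>

lemma ot_cost_le_glue:
  fixes a b c :: "'a::polish_space measure"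
  assumes k: "k \<in> couplings a b" and l: "l \<in> couplings b c" and "d > 0" "p \<ge> 0" "e > 0"
  shows "ot_cost p a c \<le> ennreal ((1 + d) powr p) * transport_cost p l +
    ennreal ((1 + 1 / d) powr p * 2 powr p) * (transport_cost p k + ennreal (e powr p))"
proof -
  note k = couplingsD[OF k] and l = couplingsD[OF l]
  note [measurable_cong] = k(2) l(2)
  obtain idx :: "'a \<Rightarrow> nat" where idx[measurable]: "idx \<in> borel \<rightarrow>\<^sub>M count_space UNIV"
    and small: "\<And>x y. idx x = idx y \<Longrightarrow> dist x y < e"
    using countable_label_of_small_cells[OF \<open>e > 0\<close>] by metis
  \<comment> \<open>Both couplings give the label the same law, that of \<open>idx\<close> under the
    shared marginal \<open>b\<close>.\<close>
  have k_fiber: "emeasure k {x \<in> space k. idx (snd x) = n} = emeasure b {y. idx y = n}" for n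
    unfolding k(4)[symmetric] by (subst emeasure_distr) (auto intro!: arg_cong2[where f=emeasure])
  have l_fiber: "emeasure l {x \<in> space l. idx (fst x) = n} = emeasure b {y. idx y = n}" for n
    unfolding l(3)[symmetric] by (subst emeasure_distr) (auto intro!: arg_cong2[where f=emeasure])
  obtain K where K: "sets K = sets (k \<Otimes>\<^sub>M l)" "distr K k fst = k" "distr K l snd = l"
    "AE z in K. idx (snd (fst z)) = idx (fst (snd z))"
    by (rule coupling_with_equal_labels[OF k(1) l(1), of "\<lambda>x. idx (snd x)" "\<lambda>x. idx (fst x)"])
      (auto simp: k_fiber l_fiber)
  note [measurable_cong] = K(1)
  have "prob_space K"
    by (rule prob_space_distrD[of fst K k]) (auto simp: K k)
  have k_eq: "(\<integral>\<^sup>+x. h x \<partial>k) = (\<integral>\<^sup>+z. h (fst z) \<partial>K)" if [measurable]: "h \<in> borel_measurable k" for h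
    by (subst K(2)[symmetric], subst nn_integral_distr) auto
  have l_eq: "(\<integral>\<^sup>+x. h x \<partial>l) = (\<integral>\<^sup>+z. h (snd z) \<partial>K)" if [measurable]: "h \<in> borel_measurable l" for h
    by (subst K(3)[symmetric], subst nn_integral_distr) auto
  have dk: "distr K borel (\<lambda>z. fst (fst z)) = a"
    using k(3) distr_distr[of fst k borel fst K] by (simp add: K(2) o_def)
  have dl: "distr K borel (\<lambda>z. snd (snd z)) = c"
    using l(4) distr_distr[of snd l borel snd K] by (simp add: K(3) o_def)
  let ?A = "(1 + d) powr p" and ?B = "(1 + 1 / d) powr p * 2 powr p"
  have "distr K (borel \<Otimes>\<^sub>M borel) (\<lambda>z. (fst (fst z), snd (snd z))) \<in> couplings a c"
    by (rule coupling_distrI[OF \<open>prob_space K\<close> _ _ dk dl]) measurable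
  from ot_cost_le[OF this, of p]
  have "ot_cost p a c \<le> (\<integral>\<^sup>+z. ennreal (dist (fst (fst z)) (snd (snd z)) powr p) \<partial>K)"
    by (subst (asm) transport_cost_distr) measurable
  also have "\<dots> \<le> (\<integral>\<^sup>+z. ennreal ?A * ennreal (dist (fst (snd z)) (snd (snd z)) powr p)
      + ennreal ?B * (ennreal (dist (fst (fst z)) (snd (fst z)) powr p) + ennreal (e powr p)) \<partial>K)"
  proof (rule nn_integral_mono_AE)
    show "AE z in K. ennreal (dist (fst (fst z)) (snd (snd z)) powr p)
      \<le> ennreal ?A * ennreal (dist (fst (snd z)) (snd (snd z)) powr p)
      + ennreal ?B * (ennreal (dist (fst (fst z)) (snd (fst z)) powr p) + ennreal (e powr p))"
      using K(4)
    proof eventually_elim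
      fix z :: "('a \<times> 'a) \<times> 'a \<times> 'a"
      obtain x y y' w where z: "z = ((x, y), (y', w))" by (metis surj_pair)
      assume "idx (snd (fst z)) = idx (fst (snd z))"
      then have "dist y y' < e"
        by (auto simp: z intro: small)
      \<comment> \<open>The weighted inequality is applied twice: with \<open>d\<close> to separate
        \<open>dist y' w\<close> from the rest, then with \<open>1\<close> to separate
        \<open>dist x y\<close> from \<open>e\<close>, which produces the factor
        \<open>2 powr p\<close>.\<close>
      then have "dist x w \<le> dist y' w + (dist x y + e)"
        using dist_triangle[of x w y'] dist_triangle[of x y' y] by linarith
      then have "dist x w powr p \<le> (dist y' w + (dist x y + e)) powr p"
        using \<open>p \<ge> 0\<close> by (intro powr_mono2) auto
      also have "\<dots> \<le> ?A * dist y' w powr p + (1 + 1 / d) powr p * (dist x y + e) powr p"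
        using assms by (intro powr_add_le_weighted) auto
      also have "\<dots> \<le> ?A * dist y' w powr p + (1 + 1 / d) powr p * (2 powr p * dist x y powr p + 2 powr p * e powr p)"
        using powr_add_le_weighted[of "dist x y" e 1 p] assms
        by (intro add_left_mono mult_left_mono) auto
      also have "\<dots> = ?A * dist y' w powr p + ?B * (dist x y powr p + e powr p)"
        by (simp add: algebra_simps)
      finally show "ennreal (dist (fst (fst z)) (snd (snd z)) powr p)
        \<le> ennreal ?A * ennreal (dist (fst (snd z)) (snd (snd z)) powr p)
        + ennreal ?B * (ennreal (dist (fst (fst z)) (snd (fst z)) powr p) + ennreal (e powr p))"
        by (simp add: z flip: ennreal_plus ennreal_mult)
    qed
  qed
  also have "\<dots> = ennreal ?A * transport_cost p l + ennreal ?B * (transport_cost p k + ennreal (e powr p))"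
    using prob_space.emeasure_space_1[OF \<open>prob_space K\<close>]
    by (simp add: nn_integral_add nn_integral_cmult transport_cost_eq k_eq l_eq)
  finally show ?thesis .
qed

text \<open>Glue almost optimal couplings along ever finer cells. As \<open>d\<close> tends to 0 the
  factor of \<open>ot_cost p b c\<close> tends to 1; the other factor blows up, which is harmless
  when \<open>ot_cost p a b\<close> tends to 0 for fixed \<open>d\<close>.\<close>

lemma ot_cost_quasi_triangle:
  fixes a b c :: "'a::polish_space measure"
  assumes "d > 0" "p > 0" "ot_cost p a b < \<infinity>" "ot_cost p b c < \<infinity>"
  shows "ot_cost p a c \<le> ennreal ((1 + d) powr p) * ot_cost p b c +
    ennreal ((1 + 1 / d) powr p * 2 powr p) * ot_cost p a b"
proof (rule ennreal_le_epsilon)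
  let ?A = "(1 + d) powr p" and ?B = "(1 + 1 / d) powr p * 2 powr p"
  fix \<eta> :: real assume \<eta>: "\<eta> > 0"
  \<comment> \<open>The error \<epsilon> enters once with factor \<open>?A\<close>, from the choice
    of \<open>l\<close>, and twice with factor \<open>?B\<close>: from the choice of
    \<open>k\<close> and from the cell size \<open>\<epsilon> powr (1 / p)\<close>.\<close>
  define \<epsilon> where "\<epsilon> = \<eta> / (?A + 2 * ?B)"
  have AB: "?A > 0" "?B > 0"
    using \<open>d > 0\<close> add_pos_pos[of 1 d] add_pos_pos[of 1 "1 / d"] by auto
  then have "0 < ?A + 2 * ?B"
    by linarith
  then have \<epsilon>: "\<epsilon> > 0" "(?A + 2 * ?B) * \<epsilon> = \<eta>"
    unfolding \<epsilon>_def using \<eta> by (rule divide_pos_pos[rotated], simp add: field_simps)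
  obtain k where k: "k \<in> couplings a b" "transport_cost p k \<le> ot_cost p a b + ennreal \<epsilon>"
    using INF_approx_ennreal[OF \<epsilon>(1) ot_cost_def[of p a b]] assms(3)
    by (metis infinity_ennreal_def less_imp_le less_irrefl)
  obtain l where l: "l \<in> couplings b c" "transport_cost p l \<le> ot_cost p b c + ennreal \<epsilon>"
    using INF_approx_ennreal[OF \<epsilon>(1) ot_cost_def[of p b c]] assms(4)
    by (metis infinity_ennreal_def less_imp_le less_irrefl)
  have "(\<epsilon> powr (1 / p)) powr p = \<epsilon>"
    using \<epsilon>(1) \<open>p > 0\<close> by (simp add: powr_powr)
  then have "ot_cost p a c \<le> ennreal ?A * transport_cost p l + ennreal ?B * (transport_cost p k + ennreal \<epsilon>)"
    using ot_cost_le_glue[OF k(1) l(1) \<open>d > 0\<close>, of p "\<epsilon> powr (1 / p)"] \<epsilon>(1) \<open>p > 0\<close> by simp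
  also have "\<dots> \<le> ennreal ?A * (ot_cost p b c + ennreal \<epsilon>) + ennreal ?B * (ot_cost p a b + ennreal \<epsilon> + ennreal \<epsilon>)"
    by (intro add_mono mult_left_mono k l) auto
  also have "\<dots> = ennreal ?A * ot_cost p b c + ennreal ?B * ot_cost p a b + ennreal ((?A + 2 * ?B) * \<epsilon>)"
  proof -
    have "ennreal ((?A + 2 * ?B) * \<epsilon>) = ennreal ?A * ennreal \<epsilon> + (ennreal ?B * ennreal \<epsilon> + ennreal ?B * ennreal \<epsilon>)"
      using AB \<epsilon>(1) by (simp add: algebra_simps flip: ennreal_plus ennreal_mult)
    then show ?thesis
      by (simp add: distrib_left add_ac)
  qed
  finally show "ot_cost p a c \<le> ennreal ?A * ot_cost p b c + ennreal ?B * ot_cost p a b + ennreal \<eta>"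
    by (simp only: \<epsilon>(2))
qed

text \<open>The product measure is a coupling of finite cost: go from \<open>x\<close> to
  \<open>y\<close> through the base points \<open>x0\<close> and \<open>y0\<close> of the two moment
  conditions.\<close>

lemma ot_cost_finite:
  fixes \<mu> \<nu> :: "'a::polish_space measure"
  assumes "\<mu> \<in> finite_moment_measures p" "\<nu> \<in> finite_moment_measures p" "p > 0"
  shows "ot_cost p \<mu> \<nu> < \<infinity>"
proof -
  from assms obtain x0 y0 where \<mu>: "prob_space \<mu>" and s\<mu>[measurable_cong]: "sets \<mu> = sets borel"
    and fin\<mu>: "(\<integral>\<^sup>+x. ennreal (dist x0 x powr p) \<partial>\<mu>) < \<infinity>"
    and \<nu>: "prob_space \<nu>" and s\<nu>[measurable_cong]: "sets \<nu> = sets borel"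
    and fin\<nu>: "(\<integral>\<^sup>+x. ennreal (dist y0 x powr p) \<partial>\<nu>) < \<infinity>"
    unfolding finite_moment_measures_def by auto
  interpret \<mu>: prob_space \<mu> by fact
  interpret \<nu>: prob_space \<nu> by fact
  interpret P: pair_prob_space \<mu> \<nu> ..
  have dist_fst: "distr (\<mu> \<Otimes>\<^sub>M \<nu>) borel fst = \<mu>"
  proof (rule measure_eqI)
    fix A assume "A \<in> sets (distr (\<mu> \<Otimes>\<^sub>M \<nu>) borel fst)"
    then have A: "A \<in> sets \<mu>" by (simp add: s\<mu>)
    have "fst -` A \<inter> space (\<mu> \<Otimes>\<^sub>M \<nu>) = A \<times> space \<nu>"
      using sets.sets_into_space[OF A] by (auto simp: space_pair_measure)
    then show "emeasure (distr (\<mu> \<Otimes>\<^sub>M \<nu>) borel fst) A = emeasure \<mu> A"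
      using A by (simp add: emeasure_distr s\<mu> \<nu>.emeasure_pair_measure_Times \<nu>.emeasure_space_1)
  qed (simp add: s\<mu>)
  have dist_snd: "distr (\<mu> \<Otimes>\<^sub>M \<nu>) borel snd = \<nu>"
  proof (rule measure_eqI)
    fix A assume "A \<in> sets (distr (\<mu> \<Otimes>\<^sub>M \<nu>) borel snd)"
    then have A: "A \<in> sets \<nu>" by (simp add: s\<nu>)
    have "snd -` A \<inter> space (\<mu> \<Otimes>\<^sub>M \<nu>) = space \<mu> \<times> A"
      using sets.sets_into_space[OF A] by (auto simp: space_pair_measure)
    then show "emeasure (distr (\<mu> \<Otimes>\<^sub>M \<nu>) borel snd) A = emeasure \<nu> A"
      using A by (simp add: emeasure_distr s\<nu> \<nu>.emeasure_pair_measure_Times \<mu>.emeasure_space_1)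
  qed (simp add: s\<nu>)
  have "\<mu> \<Otimes>\<^sub>M \<nu> \<in> couplings \<mu> \<nu>"
    using P.prob_space_axioms dist_fst dist_snd
    by (simp add: couplings_def cong: sets_pair_measure_cong[OF s\<mu> s\<nu>])
  then have "ot_cost p \<mu> \<nu> \<le> (\<integral>\<^sup>+z. ennreal (dist (fst z) (snd z) powr p) \<partial>(\<mu> \<Otimes>\<^sub>M \<nu>))"
    using ot_cost_le transport_cost_eq by metis
  also have "\<dots> \<le> (\<integral>\<^sup>+z. ennreal (2 powr p) * ennreal (dist x0 (fst z) powr p)
    + ennreal (2 powr p * 2 powr p) * (ennreal (dist y0 (snd z) powr p) + ennreal (dist x0 y0 powr p)) \<partial>(\<mu> \<Otimes>\<^sub>M \<nu>))"
  proof (rule nn_integral_mono)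
    fix z :: "'a \<times> 'a"
    obtain x y where z: "z = (x, y)" by (cases z)
    have "dist x y \<le> dist x0 x + (dist y0 y + dist x0 y0)"
      using dist_triangle2[of x y x0] dist_triangle[of x0 y y0] by (simp add: dist_commute)
    then have "dist x y powr p \<le> (dist x0 x + (dist y0 y + dist x0 y0)) powr p"
      using \<open>p > 0\<close> by (intro powr_mono2) auto
    also have "\<dots> \<le> 2 powr p * dist x0 x powr p + 2 powr p * (dist y0 y + dist x0 y0) powr p"
      using powr_add_le_weighted[of "dist x0 x" "dist y0 y + dist x0 y0" 1 p] \<open>p > 0\<close> by simp
    also have "\<dots> \<le> 2 powr p * dist x0 x powr p + 2 powr p * (2 powr p * dist y0 y powr p + 2 powr p * dist x0 y0 powr p)"
      using powr_add_le_weighted[of "dist y0 y" "dist x0 y0" 1 p] \<open>p > 0\<close>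
      by (intro add_left_mono mult_left_mono) auto
    also have "\<dots> = 2 powr p * dist x0 x powr p + (2 powr p * 2 powr p) * (dist y0 y powr p + dist x0 y0 powr p)"
      by (simp add: algebra_simps)
    finally show "ennreal (dist (fst z) (snd z) powr p) \<le> ennreal (2 powr p) * ennreal (dist x0 (fst z) powr p)
      + ennreal (2 powr p * 2 powr p) * (ennreal (dist y0 (snd z) powr p) + ennreal (dist x0 y0 powr p))"
      by (simp add: z flip: ennreal_plus ennreal_mult)
  qed
  also have "\<dots> = ennreal (2 powr p) * (\<integral>\<^sup>+z. ennreal (dist x0 (fst z) powr p) \<partial>(\<mu> \<Otimes>\<^sub>M \<nu>))
    + ennreal (2 powr p * 2 powr p) * ((\<integral>\<^sup>+z. ennreal (dist y0 (snd z) powr p) \<partial>(\<mu> \<Otimes>\<^sub>M \<nu>)) + ennreal (dist x0 y0 powr p))"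
    using P.emeasure_space_1 by (simp add: nn_integral_add nn_integral_cmult)
  also have "(\<integral>\<^sup>+z. ennreal (dist x0 (fst z) powr p) \<partial>(\<mu> \<Otimes>\<^sub>M \<nu>)) = (\<integral>\<^sup>+x. ennreal (dist x0 x powr p) \<partial>\<mu>)"
    by (subst (2) dist_fst[symmetric], subst nn_integral_distr) auto
  also have "(\<integral>\<^sup>+z. ennreal (dist y0 (snd z) powr p) \<partial>(\<mu> \<Otimes>\<^sub>M \<nu>)) = (\<integral>\<^sup>+x. ennreal (dist y0 x powr p) \<partial>\<nu>)"
    by (subst (2) dist_snd[symmetric], subst nn_integral_distr) auto
  finally show ?thesis
    using fin\<mu> fin\<nu> by (auto simp: ennreal_mult_less_top le_less_trans)
qed

text \<open>Finiteness matters, as \<open>enn2real\<close> sends \<open>\<infinity>\<close> to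
  \<open>0\<close>.\<close>

lemma wasserstein_powr:
  assumes "ot_cost p \<mu> \<nu> < \<infinity>" "p > 0"
  shows "ennreal (wasserstein p \<mu> \<nu> powr p) = ot_cost p \<mu> \<nu>"
  using assms by (simp add: wasserstein_def powr_powr ot_cost_def less_top)

subsection \<open>Lifts of minimal energy\<close>

lemma is_liftD:
  fixes \<mu> :: "real \<Rightarrow> 'a::polish_space measure"
  assumes "is_lift T \<mu> \<pi>"
  shows "prob_space \<pi>" "sets \<pi> = sets (metric_borel (path_space T))"
    "\<And>t. t \<in> {0..T} \<Longrightarrow> distr \<pi> borel (\<lambda>\<gamma>. \<gamma> t) = \<mu> t"
    "\<And>t. t \<in> {0..T} \<Longrightarrow> (\<lambda>\<gamma>. \<gamma> t) \<in> borel_measurable \<pi>"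
    "\<And>\<gamma>. \<gamma> \<in> space \<pi> \<Longrightarrow> continuous_on {0..T} \<gamma>"
proof -
  show sets: "sets \<pi> = sets (metric_borel (path_space T))"
    using assms by (simp add: is_lift_def)
  show "prob_space \<pi>" "\<And>t. t \<in> {0..T} \<Longrightarrow> distr \<pi> borel (\<lambda>\<gamma>. \<gamma> t) = \<mu> t"
    using assms by (auto simp: is_lift_def)
  show "(\<lambda>\<gamma>. \<gamma> t) \<in> borel_measurable \<pi>" if "t \<in> {0..T}" for t
    using measurable_evaluation[OF that] by (simp cong: measurable_cong_sets[OF sets refl])
  have "space \<pi> = mspace (path_space T :: (real \<Rightarrow> 'a) metric)"
    using sets_eq_imp_space_eq[OF sets] by (simp add: metric_borel_def space_measure_of_conv)
  then show "continuous_on {0..T} \<gamma>" if "\<gamma> \<in> space \<pi>" for \<gamma>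
    using that path_continuous_on by simp
qed

lemma ennreal_powr_inverse_powr:
  assumes "p > 0"
  shows "ennreal_powr (ennreal_powr x (1 / p)) p = x"
  using assms by (cases x) (auto simp: ennreal_powr_def powr_powr)

text \<open>The function \<open>g\<close> of the overview; for a lift it is the transport cost of
  the joint law at times \<open>s\<close> and \<open>t\<close>.\<close>

definition mean_cost :: "real \<Rightarrow> (real \<Rightarrow> 'a::polish_space) measure \<Rightarrow> real \<Rightarrow> real \<Rightarrow> ennreal" where
  "mean_cost p \<pi> s t = (\<integral>\<^sup>+\<gamma>. ennreal (dist (\<gamma> s) (\<gamma> t) powr p) \<partial>\<pi>)"

text \<open>Tonelli, once the integrand is known to be jointly measurable in the path and the two
  times.\<close>

lemma lift_energy_Fubini:
  fixes \<mu> :: "real \<Rightarrow> 'a::polish_space measure" and \<alpha> p T :: real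
  assumes "0 \<le> T" "p > 0" and lift: "is_lift T \<mu> \<pi>"
  defines "G \<equiv> \<lambda>z. mean_cost p \<pi> (fst z) (snd z) *
      ennreal (\<bar>snd z - fst z\<bar> powr (- 1 - \<alpha> * p)) * indicator ({0..T} \<times> {0..T}) z"
  shows "G \<in> borel_measurable (lborel \<Otimes>\<^sub>M lborel)"
    and "(\<integral>\<^sup>+\<gamma>. ennreal_powr (sobolev_seminorm dist T \<alpha> p \<gamma>) p \<partial>\<pi>) = integral\<^sup>N (lborel \<Otimes>\<^sub>M lborel) G"
proof -
  note lift = is_liftD[OF lift]
  interpret \<pi>: prob_space \<pi> by (rule lift)
  interpret P: pair_sigma_finite \<pi> "lborel \<Otimes>\<^sub>M lborel :: (real \<times> real) measure"
    unfolding lborel_prod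
    by (intro pair_sigma_finite.intro \<pi>.sigma_finite_measure_axioms sigma_finite_lborel)
  \<comment> \<open>Clipped times make the integrand \<open>H\<close> measurable on the whole
    product; the indicator in \<open>w\<close> removes what clipping changes.\<close>
  define c where "c t = max 0 (min T t)" for t
  define w where "w z = ennreal (\<bar>snd z - fst z\<bar> powr (- 1 - \<alpha> * p)) * indicator ({0..T} \<times> {0..T}) z"
    for z :: "real \<times> real"
  have [measurable]: "w \<in> borel_measurable (lborel \<Otimes>\<^sub>M lborel)"
    unfolding w_def by measurable
  define H where "H x = ennreal (dist (fst x (c (fst (snd x)))) (fst x (c (snd (snd x)))) powr p) * w (snd x)"
    for x :: "(real \<Rightarrow> 'a) \<times> real \<times> real"
  have E: "(\<lambda>(\<gamma>, t). \<gamma> (c t)) \<in> borel_measurable (\<pi> \<Otimes>\<^sub>M borel)"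
    unfolding c_def by (rule measurable_path_evaluation[OF \<open>0 \<le> T\<close> lift(4,5)])
  have [measurable]: "(\<lambda>x. fst x (c (fst (snd x)))) \<in> borel_measurable (\<pi> \<Otimes>\<^sub>M (lborel \<Otimes>\<^sub>M lborel))"
  proof -
    have "(\<lambda>x. (fst x, fst (snd x))) \<in> \<pi> \<Otimes>\<^sub>M (lborel \<Otimes>\<^sub>M lborel) \<rightarrow>\<^sub>M \<pi> \<Otimes>\<^sub>M (borel :: real measure)"
      by measurable
    from measurable_compose[OF this E] show ?thesis
      by simp
  qed
  have [measurable]: "(\<lambda>x. fst x (c (snd (snd x)))) \<in> borel_measurable (\<pi> \<Otimes>\<^sub>M (lborel \<Otimes>\<^sub>M lborel))"
  proof -
    have "(\<lambda>x. (fst x, snd (snd x))) \<in> \<pi> \<Otimes>\<^sub>M (lborel \<Otimes>\<^sub>M lborel) \<rightarrow>\<^sub>M \<pi> \<Otimes>\<^sub>M (borel :: real measure)"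
      by measurable
    from measurable_compose[OF this E] show ?thesis
      by simp
  qed
  have H[measurable]: "H \<in> borel_measurable (\<pi> \<Otimes>\<^sub>M (lborel \<Otimes>\<^sub>M lborel))"
    unfolding H_def by measurable
  have G_eq: "G z = (\<integral>\<^sup>+\<gamma>. H (\<gamma>, z) \<partial>\<pi>)" for z
  proof (cases "z \<in> {0..T} \<times> {0..T}")
    case True
    then have "c (fst z) = fst z" "c (snd z) = snd z" "fst z \<in> {0..T}" "snd z \<in> {0..T}"
      by (auto simp: c_def)
    moreover have "(\<lambda>\<gamma>. ennreal (dist (\<gamma> (fst z)) (\<gamma> (snd z)) powr p)) \<in> borel_measurable \<pi>"
      using calculation(3,4) by (intro measurable_dist_powr lift(4))
    ultimately show ?thesis
      using True by (simp add: G_def H_def w_def mean_cost_def nn_integral_multc mult.assoc)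
  qed (auto simp: G_def H_def w_def)
  have G_fun: "G = (\<lambda>z. \<integral>\<^sup>+\<gamma>. H (\<gamma>, z) \<partial>\<pi>)"
    using G_eq by blast
  show "G \<in> borel_measurable (lborel \<Otimes>\<^sub>M lborel)"
    unfolding G_fun using \<pi>.borel_measurable_nn_integral[of "\<lambda>z \<gamma>. H (\<gamma>, z)" "lborel \<Otimes>\<^sub>M lborel"]
    by (simp add: measurable_compose[OF _ H])
  have "(\<integral>\<^sup>+\<gamma>. ennreal_powr (sobolev_seminorm dist T \<alpha> p \<gamma>) p \<partial>\<pi>) =
      (\<integral>\<^sup>+\<gamma>. \<integral>\<^sup>+z. H (\<gamma>, z) \<partial>(lborel \<Otimes>\<^sub>M lborel) \<partial>\<pi>)"
    unfolding sobolev_seminorm_def ennreal_powr_inverse_powr[OF \<open>p > 0\<close>]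
    by (intro nn_integral_cong)
      (auto simp: H_def w_def c_def ennreal_mult split: split_indicator)
  also have "\<dots> = (\<integral>\<^sup>+z. \<integral>\<^sup>+\<gamma>. H (\<gamma>, z) \<partial>\<pi> \<partial>(lborel \<Otimes>\<^sub>M lborel))"
    by (rule P.Fubini[symmetric]) (rule H)
  finally show "(\<integral>\<^sup>+\<gamma>. ennreal_powr (sobolev_seminorm dist T \<alpha> p \<gamma>) p \<partial>\<pi>) = integral\<^sup>N (lborel \<Otimes>\<^sub>M lborel) G"
    unfolding G_fun .
qed

lemma lift_coupling:
  assumes "is_lift T \<mu> \<pi>" "s \<in> {0..T}" "t \<in> {0..T}"
  shows "distr \<pi> (borel \<Otimes>\<^sub>M borel) (\<lambda>\<gamma>. (\<gamma> s, \<gamma> t)) \<in> couplings (\<mu> s) (\<mu> t)"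
    and "transport_cost p (distr \<pi> (borel \<Otimes>\<^sub>M borel) (\<lambda>\<gamma>. (\<gamma> s, \<gamma> t))) = mean_cost p \<pi> s t"
    and "ot_cost p (\<mu> s) (\<mu> t) \<le> mean_cost p \<pi> s t"
proof -
  note lift = is_liftD[OF assms(1)]
  show c: "distr \<pi> (borel \<Otimes>\<^sub>M borel) (\<lambda>\<gamma>. (\<gamma> s, \<gamma> t)) \<in> couplings (\<mu> s) (\<mu> t)"
    using assms(2,3) by (intro coupling_distrI lift)
  show e: "transport_cost p (distr \<pi> (borel \<Otimes>\<^sub>M borel) (\<lambda>\<gamma>. (\<gamma> s, \<gamma> t))) = mean_cost p \<pi> s t"
    unfolding mean_cost_def using assms(2,3) by (intro transport_cost_distr lift)
  show "ot_cost p (\<mu> s) (\<mu> t) \<le> mean_cost p \<pi> s t"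
    using ot_cost_le[OF c, of p] e by simp
qed

text \<open>The weighted optimal cost \<open>F\<close> lies below the weighted mean cost
  \<open>G\<close>, and the energy identity gives them the same finite integral. They agree almost
  everywhere, and off the diagonal the weight cancels.\<close>

lemma mean_cost_eq_ot_cost_AE:
  fixes \<mu> :: "real \<Rightarrow> 'a::polish_space measure"
  assumes "0 \<le> T" "p > 0"
    and \<mu>: "\<mu> \<in> sobolev_paths (finite_moment_measures p) (wasserstein p) T \<alpha> p"
    and lift: "is_lift T \<mu> \<pi>"
    and energy: "ennreal_powr (sobolev_seminorm (wasserstein p) T \<alpha> p \<mu>) p =
           (\<integral>\<^sup>+\<gamma>. ennreal_powr (sobolev_seminorm dist T \<alpha> p \<gamma>) p \<partial>\<pi>)"
  shows "AE z in lborel \<Otimes>\<^sub>M lborel. z \<in> {0..T} \<times> {0..T} \<longrightarrow>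
    mean_cost p \<pi> (fst z) (snd z) = ot_cost p (\<mu> (fst z)) (\<mu> (snd z))"
proof -
  define w where "w z = \<bar>snd z - fst z\<bar> powr (- 1 - \<alpha> * p)" for z :: "real \<times> real"
  define G where "G = (\<lambda>z. mean_cost p \<pi> (fst z) (snd z) *
      ennreal (w z) * indicator ({0..T} \<times> {0..T}) z)"
  define F where "F = (\<lambda>z. ot_cost p (\<mu> (fst z)) (\<mu> (snd z)) *
      ennreal (w z) * indicator ({0..T} \<times> {0..T}) z)"
  have W: "ennreal (wasserstein p (\<mu> s) (\<mu> t) powr p) = ot_cost p (\<mu> s) (\<mu> t)"
    if "s \<in> {0..T}" "t \<in> {0..T}" for s t
    using that \<mu> \<open>p > 0\<close>
    by (intro wasserstein_powr ot_cost_finite) (auto simp: sobolev_paths_def continuous_path_def)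
  have "ennreal_powr (sobolev_seminorm (wasserstein p) T \<alpha> p \<mu>) p = integral\<^sup>N (lborel \<Otimes>\<^sub>M lborel) F"
    unfolding sobolev_seminorm_def ennreal_powr_inverse_powr[OF \<open>p > 0\<close>] F_def w_def
    by (intro nn_integral_cong) (auto simp: ennreal_mult W split: split_indicator)
  moreover note Fub = lift_energy_Fubini[OF \<open>0 \<le> T\<close> \<open>p > 0\<close> lift, of \<alpha>, folded w_def, folded G_def]
  moreover have "ennreal_powr (sobolev_seminorm (wasserstein p) T \<alpha> p \<mu>) p < \<infinity>"
    using \<mu> by (auto simp: sobolev_paths_def ennreal_powr_def)
  ultimately have int: "integral\<^sup>N (lborel \<Otimes>\<^sub>M lborel) F = integral\<^sup>N (lborel \<Otimes>\<^sub>M lborel) G"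
    "integral\<^sup>N (lborel \<Otimes>\<^sub>M lborel) G < \<infinity>"
    using energy by simp_all
  \<comment> \<open>The bound is required at every point; outside the square the indicator makes
    \<open>F\<close> vanish.\<close>
  have "F z \<le> G z" for z
  proof (cases "z \<in> {0..T} \<times> {0..T}")
    case True
    then show ?thesis
      unfolding F_def G_def by (intro mult_right_mono lift_coupling(3)[OF lift]) auto
  qed (simp add: F_def)
  then have "AE z in lborel \<Otimes>\<^sub>M lborel. F z = G z"
    by (rule AE_eq_of_nn_integral_eq[OF Fub(1) _ int])
  then show ?thesis
  proof eventually_elim
    fix z assume eq: "F z = G z"
    show "z \<in> {0..T} \<times> {0..T} \<longrightarrow>
      mean_cost p \<pi> (fst z) (snd z) = ot_cost p (\<mu> (fst z)) (\<mu> (snd z))"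
    proof
      assume z: "z \<in> {0..T} \<times> {0..T}"
      show "mean_cost p \<pi> (fst z) (snd z) = ot_cost p (\<mu> (fst z)) (\<mu> (snd z))"
      proof (cases "fst z = snd z")
        \<comment> \<open>On the diagonal the weight is \<open>0\<close> and cannot be cancelled,
          but there both costs are \<open>0\<close>.\<close>
        case True
        have "mean_cost p \<pi> (fst z) (snd z) = 0"
          using True \<open>p > 0\<close> by (simp add: mean_cost_def)
        then show ?thesis
          using lift_coupling(3)[OF lift, of "fst z" "snd z" p] z by auto
      next
        case False
        then have "w z > 0"
          by (simp add: w_def)
        then show ?thesis
          using eq z by (auto simp: F_def G_def mult_right_ennreal_cancel)
      qed
    qed
  qed
qed

section \<open>From almost every pair of times to every pair\<close>

text \<open>Near any point of the square, endpoints included, there is an open rectangle inside the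
  square. It has positive area because \<open>T > 0\<close>, so it cannot lie in the exceptional
  null set.\<close>

lemma AE_lborel_approx_in_square:
  assumes AE: "AE z in lborel \<Otimes>\<^sub>M lborel. z \<in> {0..T} \<times> {0..T} \<longrightarrow> P z"
    and "T > 0" "s \<in> {0..T}" "t \<in> {0..T}" "r > 0"
  shows "\<exists>s' t'. s' \<in> {0..T} \<and> t' \<in> {0..T} \<and> \<bar>s' - s\<bar> < r \<and> \<bar>t' - t\<bar> < r \<and> P (s', t' :: real)"
proof (rule ccontr)
  assume contra: "\<not> ?thesis"
  define I where "I u = {max 0 (u - r)<..<min T (u + r)}" for u
  have pos: "emeasure lborel (I u) > 0" if "u \<in> {0..T}" for u
    using that \<open>T > 0\<close> \<open>r > 0\<close> by (auto simp: I_def)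
  have I: "I s \<times> I t \<in> sets (lborel \<Otimes>\<^sub>M lborel)"
    by (intro pair_measureI) (simp_all add: I_def)
  have "AE z in lborel \<Otimes>\<^sub>M lborel. z \<notin> I s \<times> I t"
    using AE
  proof eventually_elim
    fix z :: "real \<times> real" assume "z \<in> {0..T} \<times> {0..T} \<longrightarrow> P z"
    with contra show "z \<notin> I s \<times> I t"
      by (cases z) (auto simp: I_def abs_less_iff)
  qed
  then have "emeasure (lborel \<Otimes>\<^sub>M lborel) (I s \<times> I t) = 0"
    using AE_iff_null_sets[OF I] by auto
  then show False
    using pos[OF assms(3)] pos[OF assms(4)] by (auto simp: I_def lborel.emeasure_pair_measure_Times)
qed

lemma ot_cost_tendsto_0:
  assumes "p > 0" and \<mu>: "continuous_path (finite_moment_measures p) (wasserstein p) T \<mu>"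
    and t: "t \<in> {0..T}" and u: "\<And>n. u n \<in> {0..T}" and lim: "u \<longlonglongrightarrow> t"
  shows "(\<lambda>n. ot_cost p (\<mu> (u n)) (\<mu> t)) \<longlonglongrightarrow> 0"
proof -
  have nonneg: "0 \<le> wasserstein p (\<mu> (u n)) (\<mu> t)" for n
    by (simp add: wasserstein_def)
  have "(\<lambda>n. wasserstein p (\<mu> (u n)) (\<mu> t)) \<longlonglongrightarrow> 0"
  proof (rule LIMSEQ_I)
    fix e :: real assume "e > 0"
    from \<mu> have "\<forall>t\<in>{0..T}. \<forall>\<epsilon>>0. \<exists>\<delta>>0. \<forall>s\<in>{0..T}. \<bar>s - t\<bar> < \<delta> \<longrightarrow> wasserstein p (\<mu> s) (\<mu> t) < \<epsilon>"
      by (simp add: continuous_path_def)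
    from this[rule_format, OF t \<open>e > 0\<close>] obtain d where d: "d > 0"
      "\<forall>s\<in>{0..T}. \<bar>s - t\<bar> < d \<longrightarrow> wasserstein p (\<mu> s) (\<mu> t) < e"
      by blast
    from LIMSEQ_D[OF lim d(1)] obtain N where N: "\<forall>n\<ge>N. norm (u n - t) < d"
      by blast
    show "\<exists>N. \<forall>n\<ge>N. norm (wasserstein p (\<mu> (u n)) (\<mu> t) - 0) < e"
    proof (intro exI[of _ N] allI impI)
      fix n assume "N \<le> n"
      with N d(2) u[of n] nonneg[of n] show "norm (wasserstein p (\<mu> (u n)) (\<mu> t) - 0) < e"
        by simp
    qed
  qed
  then have "(\<lambda>n. wasserstein p (\<mu> (u n)) (\<mu> t) powr p) \<longlonglongrightarrow> 0"
    by (rule tendsto_zero_powrI[OF _ tendsto_const]) (simp_all add: nonneg \<open>p > 0\<close>)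
  then have "(\<lambda>n. ennreal (wasserstein p (\<mu> (u n)) (\<mu> t) powr p)) \<longlonglongrightarrow> ennreal 0"
    by (rule tendsto_ennrealI)
  moreover have "ennreal (wasserstein p (\<mu> (u n)) (\<mu> t) powr p) = ot_cost p (\<mu> (u n)) (\<mu> t)" for n
  proof (intro wasserstein_powr ot_cost_finite \<open>p > 0\<close>)
    have "\<mu> ` {0..T} \<subseteq> finite_moment_measures p"
      using \<mu> by (simp add: continuous_path_def)
    with t u show "\<mu> (u n) \<in> finite_moment_measures p" "\<mu> t \<in> finite_moment_measures p"
      by blast+
  qed
  ultimately show ?thesis
    by simp
qed

text \<open>Approach \<open>(s, t)\<close> by good pairs \<open>(u n, v n)\<close>. Fatou bounds the
  mean cost at \<open>(s, t)\<close> by the lower limit of the costs along the sequence; these equal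
  optimal costs, whose limit is controlled by the quasi-triangle inequality.\<close>

lemma mean_cost_le_ot_cost:
  fixes \<mu> :: "real \<Rightarrow> 'a::polish_space measure"
  assumes "T > 0" "p > 0"
    and \<mu>: "continuous_path (finite_moment_measures p) (wasserstein p) T \<mu>"
    and lift: "is_lift T \<mu> \<pi>"
    and AE: "AE z in lborel \<Otimes>\<^sub>M lborel. z \<in> {0..T} \<times> {0..T} \<longrightarrow>
      mean_cost p \<pi> (fst z) (snd z) = ot_cost p (\<mu> (fst z)) (\<mu> (snd z))"
    and s: "s \<in> {0..T}" and t: "t \<in> {0..T}"
  shows "mean_cost p \<pi> s t \<le> ot_cost p (\<mu> s) (\<mu> t)"
proof -
  note l = is_liftD[OF lift]
  have fin: "ot_cost p (\<mu> x) (\<mu> y) < \<infinity>" if "x \<in> {0..T}" "y \<in> {0..T}" for x y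
  proof (intro ot_cost_finite \<open>p > 0\<close>)
    have "\<mu> ` {0..T} \<subseteq> finite_moment_measures p"
      using \<mu> by (simp add: continuous_path_def)
    with that show "\<mu> x \<in> finite_moment_measures p" "\<mu> y \<in> finite_moment_measures p"
      by blast+
  qed
  have "\<exists>s' t'. s' \<in> {0..T} \<and> t' \<in> {0..T} \<and> \<bar>s' - s\<bar> < 1 / Suc n \<and> \<bar>t' - t\<bar> < 1 / Suc n \<and>
      mean_cost p \<pi> s' t' = ot_cost p (\<mu> s') (\<mu> t')" for n
    using AE_lborel_approx_in_square[OF AE \<open>T > 0\<close> s t, of "1 / Suc n"] by simp
  then obtain u v where u: "\<And>n. u n \<in> {0..T}" "\<And>n. \<bar>u n - s\<bar> < 1 / Suc n"
    and v: "\<And>n. v n \<in> {0..T}" "\<And>n. \<bar>v n - t\<bar> < 1 / Suc n"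
    and uv: "\<And>n. mean_cost p \<pi> (u n) (v n) = ot_cost p (\<mu> (u n)) (\<mu> (v n))"
    by metis
  have lim: "x \<longlonglongrightarrow> a" if x: "\<And>n. \<bar>x n - a\<bar> < 1 / Suc n" for x and a :: real
  proof (rule LIM_zero_cancel, rule Lim_null_comparison)
    show "\<forall>\<^sub>F n in sequentially. norm (x n - a) \<le> 1 / Suc n"
      using x by (intro always_eventually allI) (simp only: real_norm_def less_imp_le)
    show "(\<lambda>n. 1 / Suc n) \<longlonglongrightarrow> (0 :: real)"
      by (rule lim_inverse_n'[THEN LIMSEQ_Suc])
  qed
  note u_lim = lim[of u s, OF u(2)] and v_lim = lim[of v t, OF v(2)]
  \<comment> \<open>Paths are continuous, so the integrand at \<open>(s, t)\<close> is the limit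
    along the sequence; this is the form to which Fatou applies.\<close>
  have "mean_cost p \<pi> s t = (\<integral>\<^sup>+\<gamma>. liminf (\<lambda>n. ennreal (dist (\<gamma> (u n)) (\<gamma> (v n)) powr p)) \<partial>\<pi>)"
    unfolding mean_cost_def
  proof (rule nn_integral_cong)
    fix \<gamma> assume "\<gamma> \<in> space \<pi>"
    then have c: "continuous_on {0..T} \<gamma>"
      by (rule l)
    have "(\<lambda>n. \<gamma> (u n)) \<longlonglongrightarrow> \<gamma> s" "(\<lambda>n. \<gamma> (v n)) \<longlonglongrightarrow> \<gamma> t"
      by (intro continuous_on_tendsto_compose[OF c u_lim s] continuous_on_tendsto_compose[OF c v_lim t]
          always_eventually allI u(1) v(1))+
    then have "(\<lambda>n. ennreal (dist (\<gamma> (u n)) (\<gamma> (v n)) powr p)) \<longlonglongrightarrow> ennreal (dist (\<gamma> s) (\<gamma> t) powr p)"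
      using \<open>p > 0\<close> by (intro tendsto_ennrealI tendsto_powr' tendsto_dist tendsto_const) auto
    then show "ennreal (dist (\<gamma> s) (\<gamma> t) powr p) = liminf (\<lambda>n. ennreal (dist (\<gamma> (u n)) (\<gamma> (v n)) powr p))"
      by (intro lim_imp_Liminf[symmetric] trivial_limit_sequentially)
  qed
  also have "\<dots> \<le> liminf (\<lambda>n. mean_cost p \<pi> (u n) (v n))"
    unfolding mean_cost_def by (intro nn_integral_liminf measurable_dist_powr l u v)
  finally have fatou: "mean_cost p \<pi> s t \<le> liminf (\<lambda>n. mean_cost p \<pi> (u n) (v n))" .
  obtain R where R: "ot_cost p (\<mu> s) (\<mu> t) = ennreal R" "R \<ge> 0"
    using fin[OF s t] by (cases "ot_cost p (\<mu> s) (\<mu> t)") auto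
  \<comment> \<open>Two quasi-triangle steps replace \<open>u n\<close> by \<open>s\<close> and then
    \<open>v n\<close> by \<open>t\<close>. For fixed \<open>d\<close> the terms with the large
    factor \<open>?B\<close> vanish as \<open>n\<close> grows, leaving one factor
    \<open>(1 + d) powr p\<close> per step.\<close>
  have bound: "mean_cost p \<pi> s t \<le> ennreal ((1 + d) powr p * (1 + d) powr p * R)" if "d > 0" for d
  proof -
    let ?A = "ennreal ((1 + d) powr p)" and ?B = "ennreal ((1 + 1 / d) powr p * 2 powr p)"
    have "mean_cost p \<pi> (u n) (v n) \<le>
      ?A * (?A * ot_cost p (\<mu> s) (\<mu> t) + ?B * ot_cost p (\<mu> (v n)) (\<mu> t)) + ?B * ot_cost p (\<mu> (u n)) (\<mu> s)" for n
    proof -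
      have "ot_cost p (\<mu> (u n)) (\<mu> (v n)) \<le> ?A * ot_cost p (\<mu> (v n)) (\<mu> s) + ?B * ot_cost p (\<mu> (u n)) (\<mu> s)"
        using ot_cost_quasi_triangle[OF \<open>d > 0\<close> \<open>p > 0\<close> fin[OF u(1)[of n] s] fin[OF s v(1)[of n]]]
        by (simp add: ot_cost_commute[of p "\<mu> (v n)"])
      also have "\<dots> \<le> ?A * (?A * ot_cost p (\<mu> t) (\<mu> s) + ?B * ot_cost p (\<mu> (v n)) (\<mu> t)) + ?B * ot_cost p (\<mu> (u n)) (\<mu> s)"
        using ot_cost_quasi_triangle[OF \<open>d > 0\<close> \<open>p > 0\<close> fin[OF v(1)[of n] t] fin[OF t s]]
        by (intro add_right_mono mult_left_mono) auto
      finally show ?thesis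
        by (simp add: uv ot_cost_commute[of p "\<mu> t" "\<mu> s"])
    qed
    then have "mean_cost p \<pi> s t \<le> liminf (\<lambda>n. ?A * (?A * ot_cost p (\<mu> s) (\<mu> t) + ?B * ot_cost p (\<mu> (v n)) (\<mu> t)) + ?B * ot_cost p (\<mu> (u n)) (\<mu> s))"
      by (intro order_trans[OF fatou] Liminf_mono always_eventually allI)
    also have "\<dots> = ?A * (?A * ot_cost p (\<mu> s) (\<mu> t) + ?B * 0) + ?B * 0"
      using ot_cost_tendsto_0[OF \<open>p > 0\<close> \<mu> s u(1) u_lim] ot_cost_tendsto_0[OF \<open>p > 0\<close> \<mu> t v(1) v_lim]
      by (intro lim_imp_Liminf tendsto_add ennreal_tendsto_cmult tendsto_const) auto
    also have "\<dots> = ennreal ((1 + d) powr p * (1 + d) powr p * R)"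
      by (simp add: R ennreal_mult mult.assoc)
    finally show ?thesis .
  qed
  \<comment> \<open>Only now does \<open>d\<close> tend to 0, along
    \<open>1 / Suc n\<close>.\<close>
  have "(\<lambda>n. ennreal ((1 + 1 / Suc n) powr p * (1 + 1 / Suc n) powr p * R)) \<longlonglongrightarrow>
      ennreal ((1 + 0) powr p * (1 + 0) powr p * R)"
    by (intro tendsto_ennrealI tendsto_intros lim_inverse_n'[THEN LIMSEQ_Suc]) auto
  then have "mean_cost p \<pi> s t \<le> ennreal ((1 + 0) powr p * (1 + 0) powr p * R)"
    by (rule LIMSEQ_le_const) (intro exI allI impI bound, simp)
  then show ?thesis
    by (simp add: R)
qed

section \<open>Compatibility from finite-dimensional marginals of the lift\<close>

theorem proposition1p4:
  fixes T p \<alpha> :: real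
    and \<mu> :: "real \<Rightarrow> ('a::polish_space) measure"
    and \<pi> :: "(real \<Rightarrow> 'a) measure"
  assumes "0 \<le> T"
    and "1 < p"
    and "1 / p < \<alpha>" and "\<alpha> < 1"
    and "\<mu> \<in> sobolev_paths (finite_moment_measures p) (wasserstein p) T \<alpha> p"
    and "is_lift T \<mu> \<pi>"
    and "ennreal_powr (sobolev_seminorm (wasserstein p) T \<alpha> p \<mu>) p =
           (\<integral>\<^sup>+\<gamma>. ennreal_powr (sobolev_seminorm dist T \<alpha> p \<gamma>) p \<partial>\<pi>)"
  shows "compatible p (\<mu> ` {0..T})"
proof -
  note lift = is_liftD[OF assms(6)]
  interpret \<pi>: prob_space \<pi> by (rule lift)
  have "p > 0" using \<open>1 < p\<close> by simp
  have path: "continuous_path (finite_moment_measures p) (wasserstein p) T \<mu>"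
    using assms(5) by (simp add: sobolev_paths_def)
  have optimal: "distr \<pi> (borel \<Otimes>\<^sub>M borel) (\<lambda>\<gamma>. (\<gamma> s, \<gamma> t)) \<in> optimal_couplings p (\<mu> s) (\<mu> t)"
    if st: "s \<in> {0..T}" "t \<in> {0..T}" "s \<noteq> t" for s t
  proof -
    \<comment> \<open>Distinct times exist only for positive \<open>T\<close>, so the degenerate
      interval needs no separate argument.\<close>
    have "T > 0" using st by auto
    have "mean_cost p \<pi> s t \<le> ot_cost p (\<mu> s) (\<mu> t)"
      using mean_cost_eq_ot_cost_AE[OF assms(1) \<open>p > 0\<close> assms(5-7)]
      by (rule mean_cost_le_ot_cost[OF \<open>T > 0\<close> \<open>p > 0\<close> path assms(6) _ st(1,2)])
    then show ?thesis
      using lift_coupling(1)[OF assms(6) st(1,2)] lift_coupling(2)[OF assms(6) st(1,2), of p] ot_cost_le[of _ "\<mu> s" "\<mu> t" p]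
      by (auto simp: optimal_couplings_def intro: order_trans)
  qed
  show ?thesis
    unfolding compatible_def
  proof (intro conjI allI impI)
    show "\<mu> ` {0..T} \<subseteq> finite_moment_measures p"
      using path by (simp add: continuous_path_def)
    fix F assume "finite F \<and> F \<subseteq> \<mu> ` {0..T}"
    then have "\<forall>\<nu>\<in>F. \<exists>t. t \<in> {0..T} \<and> \<mu> t = \<nu>"
      by blast
    \<comment> \<open>The curve may visit a measure several times; one time per measure is chosen,
      and \<kappa> is the law of the path observed at these times. Distinct measures get distinct
      times, so \<open>optimal\<close> applies.\<close>
    then obtain \<tau> where \<tau>: "\<And>\<nu>. \<nu> \<in> F \<Longrightarrow> \<tau> \<nu> \<in> {0..T}" "\<And>\<nu>. \<nu> \<in> F \<Longrightarrow> \<mu> (\<tau> \<nu>) = \<nu>"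
      by metis
    define \<kappa> where "\<kappa> = distr \<pi> (\<Pi>\<^sub>M \<nu>\<in>F. borel) (\<lambda>\<gamma>. \<lambda>\<nu>\<in>F. \<gamma> (\<tau> \<nu>))"
    have [measurable]: "(\<lambda>\<gamma>. \<lambda>\<nu>\<in>F. \<gamma> (\<tau> \<nu>)) \<in> \<pi> \<rightarrow>\<^sub>M (\<Pi>\<^sub>M \<nu>\<in>F. borel)"
      by (intro measurable_restrict lift \<tau>)
    have "distr \<kappa> borel (\<lambda>x. x \<nu>) = \<nu>" if "\<nu> \<in> F" for \<nu>
      unfolding \<kappa>_def using that lift(3)[OF \<tau>(1)] \<tau>(2) by (simp add: distr_distr o_def)
    then have "\<kappa> \<in> multi_couplings F"
      unfolding multi_couplings_def by (auto simp: \<kappa>_def intro!: \<pi>.prob_space_distr)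
    moreover have "distr \<kappa> (borel \<Otimes>\<^sub>M borel) (\<lambda>x. (x \<nu>, x \<nu>')) \<in> optimal_couplings p \<nu> \<nu>'"
      if "\<nu> \<in> F" "\<nu>' \<in> F" "\<nu> \<noteq> \<nu>'" for \<nu> \<nu>'
    proof -
      have "\<tau> \<nu> \<noteq> \<tau> \<nu>'"
        using that \<tau>(2) by metis
      from optimal[OF \<tau>(1)[OF that(1)] \<tau>(1)[OF that(2)] this] show ?thesis
        unfolding \<kappa>_def using that \<tau>(2) by (simp add: distr_distr o_def)
    qed
    ultimately show "\<exists>\<kappa>\<in>multi_couplings F. \<forall>\<mu>\<in>F. \<forall>\<nu>\<in>F. \<mu> \<noteq> \<nu> \<longrightarrow>
        distr \<kappa> (borel \<Otimes>\<^sub>M borel) (\<lambda>x. (x \<mu>, x \<nu>)) \<in> optimal_couplings p \<mu> \<nu>"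
      by blast
  qed
qed

end
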